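(* For the graphs $K_a *_\psi (K_b *_\phi G_8)$, where $a$ and $b$ are positive integers (the numbers of vertices of the complete graphs $K_a$ and $K_b$), the following equation holds: \[ D\big(K_a *_\psi (K_b *_\phi G_8)\big) = 2 . \]
   Context: All graphs are finite, simple and undirected; $u\sim v$ means $u$ and $v$ are adjacent. The distance $d(u,v)$ is the length of a shortest path from $u$ to $v$, and the diameter of $G$ is $D(G)=\max_{u,v\in V(G)} d(u,v)$. $K_n$ is the complete graph with vertex set $\{0,1,\ldots,n-1\}$. The graph $G_8$: its vertex set is $V(G_8)=\{(0,0),(0,1),(1,0),(1,1),(1,2),(2,0),(2,1),(2,2)\}$. Two distinct vertices $(i,j)$ and $(k,l)$ are adjacent if and only if either $(i,k)\in\{(0,1),(1,0),(2,2)\}$, or $(i,k)\in\{(1,2),(2,1)\}$ and $j=l$. Star product: let $G_1,G_2$ be graphs, fix an arbitrary orientation of all edges of $G_1$, and let $\vec E$ be the resulting set of arrows. For each $(u,w)\in\vec E$ let $\phi(u,w)$ be a bijection on $V(G_2)$. The graph $G_1 *_\phi G_2$ has vertex set $V(G_1)\times V(G_2)$, and $(u,v)$ is adjacent to $(w,x)$ (adjacency being taken symmetrically) if and only if either $u=w$ and $(v,x)$ is an edge of $G_2$, or $(u,w)\in\vec E$ and $x=\phi(u,w)(v)$. $m$-multiple star product: with $G_1,G_2,\vec E$ as in the previous paragraph, for each $(u,w)\in\vec E$ and $l\in\{0,\ldots,m-1\}$ let $\psi(u,w,l)$ be a bijection on $V(G_2)$. The graph $G_1 *_\psi G_2$ has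 vertex set $V(G_1)\times V(G_2)$, and $(u,v)$ is adjacent to $(w,x)$ (taken symmetrically) if and only if either $u=w$ and $(v,x)$ is an edge of $G_2$, or $(u,w)\in\vec E$ and there exists $l\in\{0,\ldots,m-1\}$ such that $x=\psi(u,w,l)(v)$. The graph $K_b *_\phi G_8$: the star product with $\vec E=\{(k_1,k_2): k_1<k_2\}$ and, for every $k_1<k_2$, \[ \phi(k_1,k_2)((i,j))=\begin{cases}(0,1-j) & i=0\\ (2,\,j+1 \bmod 3) & i=1\\ (1,\,j-1 \bmod 3) & i=2.\end{cases}\] The graph $K_a *_\psi (K_b *_\phi G_8)$: the $4$-multiple star product with $G_1=K_a$, $G_2=K_b *_\phi G_8$, $\vec E=\{(l_1,l_2): l_1<l_2\}$ and, for all $l_1<l_2$, $n\in\{0,1,2,3\}$, $k\in V(K_b)$ and $(i,j)\in V(G_8)$, $\psi(l_1,l_2,n)((k,(i,j)))=(k,\sigma_n(i,j))$, where $\sigma_0,\sigma_1,\sigma_2,\sigma_3$ are the following permutations of $V(G_8)$: $\sigma_0$: $(0,0)\mapsto(0,0)$, $(1,0)\mapsto(0,1)$, $(1,1)\mapsto(1,0)$, $(1,2)\mapsto(2,1)$, $(0,1)\mapsto(1,1)$, $(2,0)\mapsto(2,2)$, $(2,1)\mapsto(1,2)$, $(2,2)\mapsto(2,0)$. $\sigma_1$: $(0,0)\mapsto(0,1)$, $(1,0)\mapsto(1,0)$, $(1,1)\mapsto(2,1)$, $(1,2)\mapsto(0,0)$, $(0,1)\mapsto(2,2)$, $(2,0)\mapsto(1,2)$,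 $(2,1)\mapsto(2,0)$, $(2,2)\mapsto(1,1)$. $\sigma_2$: $(0,0)\mapsto(1,0)$, $(1,0)\mapsto(2,1)$, $(1,1)\mapsto(0,0)$, $(1,2)\mapsto(0,1)$, $(0,1)\mapsto(1,2)$, $(2,0)\mapsto(2,0)$, $(2,1)\mapsto(1,1)$, $(2,2)\mapsto(2,2)$. $\sigma_3$: $(0,0)\mapsto(2,1)$, $(1,0)\mapsto(0,0)$, $(1,1)\mapsto(0,1)$, $(1,2)\mapsto(1,0)$, $(0,1)\mapsto(2,0)$, $(2,0)\mapsto(1,1)$, $(2,1)\mapsto(2,2)$, $(2,2)\mapsto(1,2)$.
   Formalization: The formal theorem assumes b ≠ 2; for b = 2 the claim fails for every a ≥ 1, since the copies of (0,0) in the two layers of K_2 (same vertex of K_a) are non-adjacent and have no common neighbour, so the diameter exceeds 2. *)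

theory Defs
  imports "Graph_Theory.Pair_Digraph" "HOL-Library.Extended_Nat"
begin

text \<open>
  A finite simple undirected graph is a symmetric, loop-free pair digraph
  (locale \<open>pair_graph\<close>): an undirected edge is the two arcs joining its ends.
\<close>

section \<open>Distance and diameter\<close>

text \<open>The distance is infinite when no path exists.\<close>

definition distance :: "'a pair_pre_digraph \<Rightarrow> 'a \<Rightarrow> 'a \<Rightarrow> enat" where
  "distance G u v = (INF p \<in> {p. pre_digraph.apath (with_proj G) u p v}. enat (length p))"

definition diameter :: "'a pair_pre_digraph \<Rightarrow> enat" where
  "diameter G = Max ((\<lambda>(u, v). distance G u v) ` (pverts G \<times> pverts G))"

section \<open>Star products\<close>

definition complete_graph :: "nat \<Rightarrow> nat pair_pre_digraph" where
  "complete_graph n = \<lparr> pverts = {0..<n}, parcs = {(u, v). u < n \<and> v < n \<and> u \<noteq> v} \<rparr>"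

definition orientation :: "'a pair_pre_digraph \<Rightarrow> ('a \<times> 'a) set \<Rightarrow> bool" where
  "orientation G E \<longleftrightarrow> E \<subseteq> parcs G \<and>
     (\<forall>(u, v) \<in> parcs G. ((u, v) \<in> E) \<noteq> ((v, u) \<in> E))"

text \<open>
  In both products \<open>E\<close> is meant to be an orientation of \<open>G1\<close>, and the maps attached to
  the arrows in \<open>E\<close> are meant to be bijections on the vertices of \<open>G2\<close>.
\<close>

definition star_product ::
  "'a pair_pre_digraph \<Rightarrow> ('a \<times> 'a) set \<Rightarrow> ('a \<Rightarrow> 'a \<Rightarrow> 'b \<Rightarrow> 'b) \<Rightarrow>
   'b pair_pre_digraph \<Rightarrow> ('a \<times> 'b) pair_pre_digraph" where
  "star_product G1 E \<phi> G2 =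
    \<lparr> pverts = pverts G1 \<times> pverts G2,
      parcs = {((u, v), (w, x)).
        (u, v) \<in> pverts G1 \<times> pverts G2 \<and> (w, x) \<in> pverts G1 \<times> pverts G2 \<and>
        (u = w \<and> (v, x) \<in> parcs G2 \<or>
         (u, w) \<in> E \<and> x = \<phi> u w v \<or>
         (w, u) \<in> E \<and> v = \<phi> w u x)} \<rparr>"

definition multi_star_product ::
  "nat \<Rightarrow> 'a pair_pre_digraph \<Rightarrow> ('a \<times> 'a) set \<Rightarrow> ('a \<Rightarrow> 'a \<Rightarrow> nat \<Rightarrow> 'b \<Rightarrow> 'b) \<Rightarrow>
   'b pair_pre_digraph \<Rightarrow> ('a \<times> 'b) pair_pre_digraph" where
  "multi_star_product m G1 E \<psi> G2 =
    \<lparr> pverts = pverts G1 \<times> pverts G2,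
      parcs = {((u, v), (w, x)).
        (u, v) \<in> pverts G1 \<times> pverts G2 \<and> (w, x) \<in> pverts G1 \<times> pverts G2 \<and>
        (u = w \<and> (v, x) \<in> parcs G2 \<or>
         (u, w) \<in> E \<and> (\<exists>l<m. x = \<psi> u w l v) \<or>
         (w, u) \<in> E \<and> (\<exists>l<m. v = \<psi> w u l x))} \<rparr>"

definition increasing_arrows :: "nat \<Rightarrow> (nat \<times> nat) set" where
  "increasing_arrows n = {(u, v). u < v \<and> v < n}"

section \<open>The graphs of the theorem\<close>

text \<open>Integer labels, so that \<open>1 - j\<close> and \<open>(j - 1) mod 3\<close> are not truncated.\<close>

definition G8_verts :: "(int \<times> int) set" where
  "G8_verts = {(0,0), (0,1), (1,0), (1,1), (1,2), (2,0), (2,1), (2,2)}"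

definition G8 :: "(int \<times> int) pair_pre_digraph" where
  "G8 = \<lparr> pverts = G8_verts,
     parcs = {((i, j), (k, l)).
       (i, j) \<in> G8_verts \<and> (k, l) \<in> G8_verts \<and> (i, j) \<noteq> (k, l) \<and>
       ((i, k) \<in> {(0,1), (1,0), (2,2)} \<or> (i, k) \<in> {(1,2), (2,1)} \<and> j = l)} \<rparr>"

definition phi :: "nat \<Rightarrow> nat \<Rightarrow> int \<times> int \<Rightarrow> int \<times> int" where
  "phi k1 k2 = (\<lambda>(i, j).
     if i = 0 then (0, 1 - j)
     else if i = 1 then (2, (j + 1) mod 3)
     else (1, (j - 1) mod 3))"

definition Kb_star_G8 :: "nat \<Rightarrow> (nat \<times> int \<times> int) pair_pre_digraph" where
  "Kb_star_G8 b = star_product (complete_graph b) (increasing_arrows b) phi G8"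

definition sigma0 :: "int \<times> int \<Rightarrow> int \<times> int" where
  "sigma0 = id((0,0) := (0,0), (1,0) := (0,1), (1,1) := (1,0), (1,2) := (2,1),
               (0,1) := (1,1), (2,0) := (2,2), (2,1) := (1,2), (2,2) := (2,0))"

definition sigma1 :: "int \<times> int \<Rightarrow> int \<times> int" where
  "sigma1 = id((0,0) := (0,1), (1,0) := (1,0), (1,1) := (2,1), (1,2) := (0,0),
               (0,1) := (2,2), (2,0) := (1,2), (2,1) := (2,0), (2,2) := (1,1))"

definition sigma2 :: "int \<times> int \<Rightarrow> int \<times> int" where
  "sigma2 = id((0,0) := (1,0), (1,0) := (2,1), (1,1) := (0,0), (1,2) := (0,1),
               (0,1) := (1,2), (2,0) := (2,0), (2,1) := (1,1), (2,2) := (2,2))"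

definition sigma3 :: "int \<times> int \<Rightarrow> int \<times> int" where
  "sigma3 = id((0,0) := (2,1), (1,0) := (0,0), (1,1) := (0,1), (1,2) := (1,0),
               (0,1) := (2,0), (2,0) := (1,1), (2,1) := (2,2), (2,2) := (1,2))"

definition psi :: "nat \<Rightarrow> nat \<Rightarrow> nat \<Rightarrow> nat \<times> int \<times> int \<Rightarrow> nat \<times> int \<times> int" where
  "psi l1 l2 n = (\<lambda>(k, v). (k, ([sigma0, sigma1, sigma2, sigma3] ! n) v))"

definition Ka_star_Kb_star_G8 :: "nat \<Rightarrow> nat \<Rightarrow> (nat \<times> nat \<times> int \<times> int) pair_pre_digraph" where
  "Ka_star_Kb_star_G8 a b =
     multi_star_product 4 (complete_graph a) (increasing_arrows a) psi (Kb_star_G8 b)"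

section \<open>The data are as the products require\<close>

lemma orientation_increasing_arrows: "orientation (complete_graph n) (increasing_arrows n)"
  by (auto simp: orientation_def complete_graph_def increasing_arrows_def)

lemma bij_betw_phi: "bij_betw (phi k1 k2) (pverts G8) (pverts G8)"
  by (auto simp: bij_betw_def inj_on_def G8_def G8_verts_def phi_def)

lemma less_4_cases: "n < 4 \<Longrightarrow> n = 0 \<or> n = 1 \<or> n = 2 \<or> n = (3::nat)"
  by auto

lemma bij_betw_sigma:
  assumes "n < 4"
  shows "bij_betw ([sigma0, sigma1, sigma2, sigma3] ! n) G8_verts G8_verts"
  using less_4_cases[OF assms]
  by (elim disjE)
     (simp_all add: bij_betw_def inj_on_def G8_verts_def insert_commute
        sigma0_def sigma1_def sigma2_def sigma3_def)

lemma bij_betw_psi: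
  assumes "n < 4"
  shows "bij_betw (psi l1 l2 n) (pverts (Kb_star_G8 b)) (pverts (Kb_star_G8 b))"
proof -
  have "bij_betw (map_prod id ([sigma0, sigma1, sigma2, sigma3] ! n))
          ({0..<b} \<times> G8_verts) ({0..<b} \<times> G8_verts)"
    using bij_betw_sigma[OF assms] by (intro bij_betw_map_prod) auto
  moreover have "psi l1 l2 n = map_prod id ([sigma0, sigma1, sigma2, sigma3] ! n)"
    by (auto simp: psi_def)
  ultimately show ?thesis
    by (simp add: Kb_star_G8_def star_product_def complete_graph_def G8_def)
qed

lemma pair_graph_Kb_star_G8: "pair_graph (Kb_star_G8 b)"
proof
  let ?V = "{0..<b} \<times> G8_verts"
  have fin: "finite ?V"
    by (simp add: G8_verts_def)
  show "finite (pverts (Kb_star_G8 b))"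
    using fin by (simp add: Kb_star_G8_def star_product_def complete_graph_def G8_def)
  have "parcs (Kb_star_G8 b) \<subseteq> ?V \<times> ?V"
    by (auto simp: Kb_star_G8_def star_product_def complete_graph_def G8_def)
  then show "finite (parcs (Kb_star_G8 b))"
    using fin by (meson finite_SigmaI finite_subset)
  have G8_sym: "(y, x) \<in> parcs G8" if "(x, y) \<in> parcs G8" for x y
    using that by (auto simp: G8_def)
  show "symmetric (with_proj (Kb_star_G8 b))"
    by (auto simp: symmetric_def sym_def Kb_star_G8_def star_product_def intro: G8_sym)
  have G8_irrefl: "(x, x) \<notin> parcs G8" for x
    by (auto simp: G8_def)
  fix e assume e: "e \<in> parcs (Kb_star_G8 b)"
  then show "fst e \<in> pverts (Kb_star_G8 b)" "snd e \<in> pverts (Kb_star_G8 b)" "fst e \<noteq> snd e"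
    by (auto simp: Kb_star_G8_def star_product_def increasing_arrows_def G8_irrefl)
qed

lemma pair_graph_Ka_star_Kb_star_G8: "pair_graph (Ka_star_Kb_star_G8 a b)"
proof -
  interpret H: pair_graph "Kb_star_G8 b" by (rule pair_graph_Kb_star_G8)
  have sym: "(y, x) \<in> parcs (Kb_star_G8 b)" if "(x, y) \<in> parcs (Kb_star_G8 b)" for x y
    using that by (rule H.arcs_symmetric)
  have irrefl: "(x, x) \<notin> parcs (Kb_star_G8 b)" for x
    using H.pair_no_loops by fastforce
  show ?thesis
  proof
    let ?V = "{0..<a} \<times> pverts (Kb_star_G8 b)"
    show "finite (parcs (Ka_star_Kb_star_G8 a b))"
      by (rule finite_subset[of _ "?V \<times> ?V"])
         (auto simp: Ka_star_Kb_star_G8_def multi_star_product_def complete_graph_def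
            H.pair_finite_verts)
    show "symmetric (with_proj (Ka_star_Kb_star_G8 a b))"
      by (auto simp: symmetric_def sym_def Ka_star_Kb_star_G8_def multi_star_product_def
            intro: sym)
  qed (auto simp: Ka_star_Kb_star_G8_def multi_star_product_def complete_graph_def
         increasing_arrows_def H.pair_finite_verts irrefl)
qed

section \<open>The case \<open>b = 2\<close>\<close>

text \<open>
  The diameter of \<open>Ka_star_Kb_star_G8 a 2\<close> is not 2, so \<open>b = 2\<close> has to be excluded.
  The vertices \<open>(0, 0, 0, 0)\<close> and \<open>(0, 1, 0, 0)\<close> are neither adjacent nor have a common
  neighbour; for \<open>b \<ge> 3\<close> the copies of \<open>(0, 1)\<close> in the other layers provide one.
\<close>

lemma diameter_b2:
  assumes "a \<ge> 1"
  shows "diameter (Ka_star_Kb_star_G8 a 2) \<noteq> 2"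
proof -
  let ?G = "Ka_star_Kb_star_G8 a 2"
  define u :: "nat \<times> nat \<times> int \<times> int" where "u = (0, 0, 0, 0)"
  define v :: "nat \<times> nat \<times> int \<times> int" where "v = (0, 1, 0, 0)"
  interpret G: pair_graph ?G by (rule pair_graph_Ka_star_Kb_star_G8)
  have uv: "u \<in> pverts ?G" "v \<in> pverts ?G"
    using assms
    by (auto simp: u_def v_def Ka_star_Kb_star_G8_def multi_star_product_def Kb_star_G8_def
          star_product_def complete_graph_def G8_def G8_verts_def)
  have no_arc: "(u, v) \<notin> parcs ?G"
    by (auto simp: u_def v_def Ka_star_Kb_star_G8_def multi_star_product_def Kb_star_G8_def
          star_product_def complete_graph_def increasing_arrows_def G8_def phi_def)
  have no_mid: "(u, w) \<notin> parcs ?G \<or> (w, v) \<notin> parcs ?G" for w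
  proof -
    have nu: "w \<in> {(l, 0, x) | l x. True} \<union> {(0, 1, 0, 1)}" if "(u, w) \<in> parcs ?G"
      using that
      by (auto simp: u_def Ka_star_Kb_star_G8_def multi_star_product_def Kb_star_G8_def
            star_product_def increasing_arrows_def complete_graph_def phi_def psi_def)
    have nv: "w \<in> {(l, 1, x) | l x. True} \<union> {(0, 0, 0, 1)}" if "(w, v) \<in> parcs ?G"
      using that
      by (auto simp: v_def Ka_star_Kb_star_G8_def multi_star_product_def Kb_star_G8_def
            star_product_def increasing_arrows_def complete_graph_def phi_def psi_def
            split: if_splits)
    have "(u, 0, 0, 0, 1) \<notin> parcs ?G" "((0, 1, 0, 1), v) \<notin> parcs ?G"
      by (auto simp: u_def v_def Ka_star_Kb_star_G8_def multi_star_product_def Kb_star_G8_def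
            star_product_def increasing_arrows_def G8_def)
    with nu nv show ?thesis by auto
  qed
  have len: "3 \<le> length p" if "G.apath u p v" for p
  proof (rule ccontr)
    have p: "set p \<subseteq> parcs ?G" "pcas u p v"
      using that by (auto simp: G.apath_def G.awalk_def)
    assume "\<not> 3 \<le> length p"
    then consider "p = []" | e where "p = [e]" | e f where "p = [e, f]"
      by (cases p; cases "tl p"; cases "tl (tl p)") auto
    then show False
    proof cases
      case 1
      with p show False by (simp add: u_def v_def)
    next
      case 2
      with p no_arc show False by (cases e) auto
    next
      case 3
      with p no_mid show False by (cases e; cases f) auto
    qed
  qed
  have "enat 3 \<le> distance ?G u v"
    unfolding distance_def by (rule INF_greatest) (use len in auto)
  also have "\<dots> \<le> diameter ?G"
    unfolding diameter_def using uv by (intro Max_ge) (auto simp: G.pair_finite_verts)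
  finally have "3 \<le> diameter ?G"
    by (simp add: numeral_eq_enat)
  then show ?thesis
    by (auto simp: numeral_eq_enat)
qed

end

theory Submission
  imports Defs
begin

text \<open>
  A vertex of the product is a triple \<open>(l, k, x)\<close>: \<open>x\<close> is a vertex of \<open>G8\<close>, \<open>k\<close> one of \<open>K_b\<close> and
  \<open>l\<close> one of \<open>K_a\<close>. An edge changes the \<open>G8\<close>-part along an edge of \<open>G8\<close>, or changes \<open>k\<close> and applies
  \<open>phi\<close>, or changes \<open>l\<close> and applies some \<open>\<sigma>\<^sub>n\<close> (its inverse when \<open>l\<close> decreases). Since \<open>K_a\<close> and
  \<open>K_b\<close> are complete, a walk of at most two edges from \<open>(l, k, x)\<close> to \<open>(l', k', y)\<close> exists because
  of a property of the eight-vertex graph alone, according to which coordinates have to change: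

  \<^item> neither: \<open>G8\<close> itself has diameter two (\<open>G8_within_two\<close>);
  \<^item> only \<open>k\<close>: the edges of \<open>G8\<close>, their images under the involution \<open>phi\<close> and the pairs
    \<open>{x, phi x}\<close> cover all pairs (\<open>G8_union_phi_image\<close>), so one step along \<open>phi\<close> and one inside a
    copy of \<open>G8\<close> suffice unless \<open>x = y\<close>;
  \<^item> only \<open>l\<close>: likewise with the four \<open>\<sigma>\<^sub>n\<close> (\<open>G8_sigma_edge\<close>);
  \<^item> both: the eight vertices \<open>phi (\<sigma>\<^sub>n x)\<close> and \<open>\<sigma>\<^sub>n (phi x)\<close> exhaust \<open>G8\<close> (\<open>G8_sigma_phi\<close>).

  The exceptional pair \<open>(l, k, x)\<close>, \<open>(l, k', x)\<close> is joined through a third copy \<open>(l, m, phi x)\<close>,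
  because \<open>phi\<close> is an involution; this is where \<open>b \<noteq> 2\<close> enters. In the other direction, two
  distinct vertices \<open>(1, j)\<close> of the same copy of \<open>G8\<close> are not adjacent, so the diameter is not
  smaller than two.
\<close>

section \<open>Graphs of diameter two\<close>

definition within_two :: "'a pair_pre_digraph \<Rightarrow> 'a \<Rightarrow> 'a \<Rightarrow> bool" where
  "within_two G u v \<longleftrightarrow>
     u = v \<or> (u, v) \<in> parcs G \<or> (\<exists>w. (u, w) \<in> parcs G \<and> (w, v) \<in> parcs G)"

lemma within_two_sym:
  assumes "pair_graph G" and "within_two G u v"
  shows "within_two G v u"
proof -
  interpret pair_graph G by fact
  show ?thesis
    using assms(2) arcs_symmetric unfolding within_two_def by blast
qed

lemma distance_le_2:
  assumes "pair_graph G" and "u \<in> pverts G" and "within_two G u v"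
  shows "distance G u v \<le> 2"
proof -
  interpret pair_graph G by fact
  have ends: "x \<in> pverts G" "y \<in> pverts G" "x \<noteq> y" if "(x, y) \<in> parcs G" for x y
    using in_arcsD1[OF that] in_arcsD2[OF that] no_loops'[OF that] by auto
  have "\<exists>p. apath u p v \<and> length p \<le> 2"
  proof (cases "u = v \<or> (u, v) \<in> parcs G")
    case True
    then show ?thesis
    proof
      assume "u = v"
      with assms(2) show ?thesis
        by (intro exI[of _ "[]"]) (simp add: apath_def awalk_def)
    next
      assume "(u, v) \<in> parcs G"
      with ends show ?thesis
        by (intro exI[of _ "[(u, v)]"]) (simp add: apath_def awalk_def)
    qed
  next
    case False
    with assms(3) obtain w where "(u, w) \<in> parcs G" "(w, v) \<in> parcs G"
      by (auto simp: within_two_def)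
    with ends[of u w] ends[of w v] False show ?thesis
      by (intro exI[of _ "[(u, w), (w, v)]"]) (simp add: apath_def awalk_def)
  qed
  then obtain p where "apath u p v" "length p \<le> 2" by blast
  then have "distance G u v \<le> enat (length p)"
    unfolding distance_def by (intro INF_lower) simp
  also have "\<dots> \<le> 2"
    using \<open>length p \<le> 2\<close> by (simp add: numeral_eq_enat)
  finally show ?thesis .
qed

lemma distance_ge_2:
  assumes "u \<noteq> v" and "(u, v) \<notin> parcs G"
  shows "2 \<le> distance G u v"
proof -
  have "2 \<le> length p" if "pre_digraph.apath (with_proj G) u p v" for p
  proof -
    have p: "set p \<subseteq> parcs G" "pre_digraph.cas (with_proj G) u p v"
      using that by (auto simp: pre_digraph.apath_def pre_digraph.awalk_def)
    show ?thesis
    proof (rule ccontr)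
      assume "\<not> 2 \<le> length p"
      then consider "p = []" | e where "p = [e]"
        by (cases p; cases "tl p") auto
      then show False
        using p assms by cases (auto simp: pre_digraph.cas.simps)
    qed
  qed
  then show ?thesis
    unfolding distance_def by (intro INF_greatest) (simp add: numeral_eq_enat)
qed

lemma diameter_eq_2I:
  assumes G: "pair_graph G"
    and near: "\<And>u v. u \<in> pverts G \<Longrightarrow> v \<in> pverts G \<Longrightarrow> within_two G u v"
    and far: "u\<^sub>0 \<in> pverts G" "v\<^sub>0 \<in> pverts G" "u\<^sub>0 \<noteq> v\<^sub>0" "(u\<^sub>0, v\<^sub>0) \<notin> parcs G"
  shows "diameter G = 2"
proof -
  interpret pair_graph G by fact
  have "diameter G \<le> 2"
    unfolding diameter_def using far(1) distance_le_2[OF G _ near]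
    by (subst Max_le_iff) (auto simp: pair_finite_verts)
  moreover have "distance G u\<^sub>0 v\<^sub>0 \<le> diameter G"
    unfolding diameter_def using far(1,2) by (intro Max_ge) (auto simp: pair_finite_verts)
  then have "2 \<le> diameter G"
    using distance_ge_2[OF far(3,4)] by (rule order_trans[rotated])
  ultimately show ?thesis by (rule antisym)
qed

section \<open>Finite properties of the eight-vertex graph\<close>

definition sigma :: "nat \<Rightarrow> int \<times> int \<Rightarrow> int \<times> int" where
  "sigma n = [sigma0, sigma1, sigma2, sigma3] ! n"

lemma sigma_simps:
  "sigma 0 = sigma0" "sigma (Suc 0) = sigma1" "sigma 2 = sigma2" "sigma 3 = sigma3"
  by (simp_all add: sigma_def)

lemma ex_less_4: "(\<exists>n<4. P n) \<longleftrightarrow> P 0 \<or> P 1 \<or> P 2 \<or> P (3::nat)"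
  using less_4_cases by force

lemma G8_arc_iff:
  "((i, j), (k, l)) \<in> parcs G8 \<longleftrightarrow>
     (i, j) \<in> G8_verts \<and> (k, l) \<in> G8_verts \<and> (i, j) \<noteq> (k, l) \<and>
     ((i, k) \<in> {(0,1), (1,0), (2,2)} \<or> (i, k) \<in> {(1,2), (2,1)} \<and> j = l)"
  by (simp add: G8_def)

lemma phi_in_G8: "x \<in> G8_verts \<Longrightarrow> phi k k' x \<in> G8_verts"
  by (auto simp: G8_verts_def phi_def)

lemma sigma_in_G8: "n < 4 \<Longrightarrow> x \<in> G8_verts \<Longrightarrow> sigma n x \<in> G8_verts"
  using bij_betw_sigma[of n] by (auto simp: sigma_def bij_betw_def)

text \<open>
  The orientation of \<open>K_b\<close> is therefore immaterial: a step along \<open>phi\<close> looks the same in both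
  directions.
\<close>

lemma phi_involution: "x \<in> G8_verts \<Longrightarrow> phi k k' (phi m m' x) = x"
  by (auto simp: G8_verts_def phi_def)

lemma G8_within_two:
  assumes "x \<in> G8_verts" "y \<in> G8_verts"
  shows "within_two G8 x y"
proof -
  have "\<forall>x\<in>G8_verts. \<forall>y\<in>G8_verts. x = y \<or> (x, y) \<in> parcs G8 \<or>
          (\<exists>w\<in>G8_verts. (x, w) \<in> parcs G8 \<and> (w, y) \<in> parcs G8)"
    by (simp add: G8_arc_iff G8_verts_def)
  then show ?thesis
    using assms unfolding within_two_def by blast
qed

text \<open>
  The two alternatives with an arc are the two orders in which a step along \<open>phi\<close> and a step inside
  a copy of \<open>G8\<close> can be combined to go from \<open>x\<close> to \<open>phi y\<close>.
\<close>

lemma G8_union_phi_image: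
  assumes "x \<in> G8_verts" "y \<in> G8_verts" "x \<noteq> y"
  shows "y = phi k k' x \<or> (x, y) \<in> parcs G8 \<or> (phi k k' x, phi k k' y) \<in> parcs G8"
proof -
  have "\<forall>x\<in>G8_verts. \<forall>y\<in>G8_verts. x = y \<or> y = phi k k' x \<or> (x, y) \<in> parcs G8 \<or>
          (phi k k' x, phi k k' y) \<in> parcs G8"
    by (simp add: G8_arc_iff G8_verts_def phi_def)
  then show ?thesis
    using assms by blast
qed

text \<open>
  The three alternatives are a single step along \<open>\<sigma>\<^sub>n\<close>, such a step followed by an edge of \<open>G8\<close>, and
  such a step preceded by one.
\<close>

lemma G8_sigma_edge:
  assumes "x \<in> G8_verts" "y \<in> G8_verts"
  shows "\<exists>n<4. y = sigma n x \<or> (sigma n x, y) \<in> parcs G8 \<or>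
           (\<exists>w\<in>G8_verts. (x, w) \<in> parcs G8 \<and> y = sigma n w)"
proof -
  have "\<forall>x\<in>G8_verts. \<forall>y\<in>G8_verts. \<exists>n<4. y = sigma n x \<or> (sigma n x, y) \<in> parcs G8 \<or>
           (\<exists>w\<in>G8_verts. (x, w) \<in> parcs G8 \<and> y = sigma n w)"
    unfolding ex_less_4
    by (simp add: sigma_simps sigma0_def sigma1_def sigma2_def sigma3_def G8_arc_iff G8_verts_def)
  then show ?thesis
    using assms by blast
qed

text \<open>
  There are four maps and two orders of composition, hence at most eight images of \<open>x\<close>; the
  \<open>\<sigma>\<^sub>n\<close> are chosen so that these images are all different.
\<close>

lemma G8_sigma_phi:
  assumes "x \<in> G8_verts" "y \<in> G8_verts"
  shows "\<exists>n<4. y = phi k k' (sigma n x) \<or> y = sigma n (phi k k' x)"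
proof -
  have "\<forall>x\<in>G8_verts. \<forall>y\<in>G8_verts. \<exists>n<4. y = phi k k' (sigma n x) \<or> y = sigma n (phi k k' x)"
    unfolding ex_less_4
    by (simp add: sigma_simps sigma0_def sigma1_def sigma2_def sigma3_def phi_def G8_verts_def)
  then show ?thesis
    using assms by blast
qed

section \<open>Walks of length two in the product\<close>

lemma verts_product:
  "pverts (Ka_star_Kb_star_G8 a b) = {0..<a} \<times> {0..<b} \<times> G8_verts"
  by (simp add: Ka_star_Kb_star_G8_def multi_star_product_def Kb_star_G8_def star_product_def
        complete_graph_def G8_def)

lemma arc_same_copy:
  assumes "l < a" "k < b"
  shows "((l, k, x), (l, k, y)) \<in> parcs (Ka_star_Kb_star_G8 a b) \<longleftrightarrow> (x, y) \<in> parcs G8"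
  using assms
  by (auto simp: Ka_star_Kb_star_G8_def multi_star_product_def Kb_star_G8_def star_product_def
        complete_graph_def increasing_arrows_def G8_def)

lemma arc_phi:
  assumes "l < a" "k < b" "k' < b" "k \<noteq> k'" "x \<in> G8_verts"
  shows "((l, k, x), (l, k', phi m m' x)) \<in> parcs (Ka_star_Kb_star_G8 a b)"
proof -
  have "phi m m' x \<in> G8_verts" "phi k' k (phi m m' x) = x" "phi m m' = phi k k'"
    using assms(5) phi_in_G8 phi_involution by (auto simp: phi_def)
  with assms show ?thesis
    by (auto simp: Ka_star_Kb_star_G8_def multi_star_product_def Kb_star_G8_def star_product_def
          complete_graph_def increasing_arrows_def G8_def)
qed

lemma arc_sigma:
  assumes "l < l'" "l' < a" "k < b" "n < 4" "x \<in> G8_verts"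
  shows "((l, k, x), (l', k, sigma n x)) \<in> parcs (Ka_star_Kb_star_G8 a b)"
  using assms sigma_in_G8[OF assms(4,5)]
  by (auto simp: Ka_star_Kb_star_G8_def multi_star_product_def Kb_star_G8_def star_product_def
        complete_graph_def increasing_arrows_def G8_def psi_def sigma_def)

lemma within_two_same_layer:
  assumes "b \<noteq> 2" "l < a" "k < b" "k' < b" "x \<in> G8_verts" "y \<in> G8_verts"
  shows "within_two (Ka_star_Kb_star_G8 a b) (l, k, x) (l, k', y)"
proof -
  let ?G = "Ka_star_Kb_star_G8 a b"
  note same = arc_same_copy[OF assms(2)] and phi = arc_phi[OF assms(2)]
  consider "k = k'" | "k \<noteq> k'" "x = y" | "k \<noteq> k'" "x \<noteq> y" by blast
  then show ?thesis
  proof cases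
    case 1
    with G8_within_two[OF assms(5,6)] show ?thesis
      using assms(3) same[of k] unfolding within_two_def by blast
  next
    case 2
    then have "card {k, k'} < card {0..<b}" using assms(1,3,4) by simp
    then have "\<not> {0..<b} \<subseteq> {k, k'}"
      by (meson card_mono finite.emptyI finite.insertI not_le)
    then obtain m where m: "m < b" "m \<noteq> k" "m \<noteq> k'" by fastforce
    have "((l, k, x), (l, m, phi 0 0 x)) \<in> parcs ?G"
      using phi assms m by simp
    moreover have "((l, m, phi 0 0 x), (l, k', y)) \<in> parcs ?G"
      using phi[of m b k' "phi 0 0 x" 0 0] assms m phi_in_G8 phi_involution \<open>x = y\<close> by simp
    ultimately show ?thesis unfolding within_two_def by blast
  next
    case 3
    let ?f = "phi 0 0"
    \<comment> \<open>The finite property is applied to \<open>x\<close> and \<open>?f y\<close>, so that the walk ends in \<open>y\<close>.\<close>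
    have fy: "?f y \<in> G8_verts" "?f (?f y) = y"
      using assms(6) phi_in_G8 phi_involution by auto
    have to_y: "((l, k, ?f y), (l, k', y)) \<in> parcs ?G"
      using phi[of k b k' "?f y" 0 0] assms 3 fy by simp
    have from_x: "((l, k, x), (l, k', ?f x)) \<in> parcs ?G"
      using phi assms 3 by simp
    consider "x = ?f y" | "(x, ?f y) \<in> parcs G8" | "(?f x, y) \<in> parcs G8"
      using G8_union_phi_image[OF assms(5) fy(1), of 0 0] fy(2) phi_involution[OF assms(5)] 3
      by metis
    then show ?thesis
      by cases (use to_y from_x same assms(3,4) in \<open>unfold within_two_def, blast+\<close>)
  qed
qed

text \<open>
  Only increasing \<open>l\<close> is treated, so that each \<open>\<sigma>\<^sub>n\<close> is followed in its own direction; decreasing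
  \<open>l\<close> is the same by symmetry of the graph.
\<close>

lemma within_two_layers_less:
  assumes "l < l'" "l' < a" "k < b" "k' < b" "x \<in> G8_verts" "y \<in> G8_verts"
  shows "within_two (Ka_star_Kb_star_G8 a b) (l, k, x) (l', k', y)"
proof (cases "k = k'")
  case True
  obtain n where n: "n < 4" "y = sigma n x \<or> (sigma n x, y) \<in> parcs G8 \<or>
           (\<exists>w\<in>G8_verts. (x, w) \<in> parcs G8 \<and> y = sigma n w)"
    using G8_sigma_edge[OF assms(5,6)] by blast
  have "l < a" using assms by simp
  note facts = arc_sigma[OF assms(1-3) n(1)] arc_same_copy[OF \<open>l < a\<close> assms(3)]
    arc_same_copy[OF assms(2,3)]
  show ?thesis
    using n(2) facts assms(5) True unfolding within_two_def by blast
next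
  case False
  obtain n where n: "n < 4" "y = phi 0 0 (sigma n x) \<or> y = sigma n (phi 0 0 x)"
    using G8_sigma_phi[OF assms(5,6)] by blast
  have "l < a" using assms by simp
  have "((l, k, x), (l', k, sigma n x)) \<in> parcs (Ka_star_Kb_star_G8 a b)"
    "((l', k, sigma n x), (l', k', phi 0 0 (sigma n x))) \<in> parcs (Ka_star_Kb_star_G8 a b)"
    "((l, k, x), (l, k', phi 0 0 x)) \<in> parcs (Ka_star_Kb_star_G8 a b)"
    "((l, k', phi 0 0 x), (l', k', sigma n (phi 0 0 x))) \<in> parcs (Ka_star_Kb_star_G8 a b)"
    using assms n(1) False \<open>l < a\<close> by (auto intro: arc_sigma arc_phi phi_in_G8 sigma_in_G8)
  with n(2) show ?thesis
    unfolding within_two_def by blast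
qed

theorem mainTheorem1:
  fixes a b :: nat
  assumes "a \<ge> 1" and "b \<ge> 1" and "b \<noteq> 2"
  shows "diameter (Ka_star_Kb_star_G8 a b) = 2"
proof (rule diameter_eq_2I[OF pair_graph_Ka_star_Kb_star_G8])
  let ?G = "Ka_star_Kb_star_G8 a b"
  fix u v assume uv: "u \<in> pverts ?G" "v \<in> pverts ?G"
  obtain l k x l' k' y where [simp]: "u = (l, k, x)" "v = (l', k', y)"
    by (cases u; cases v) auto
  have mem: "l < a" "k < b" "x \<in> G8_verts" "l' < a" "k' < b" "y \<in> G8_verts"
    using uv by (simp_all add: verts_product)
  consider "l = l'" | "l < l'" | "l' < l" by linarith
  then show "within_two ?G u v"
  proof cases
    case 1
    then show ?thesis using within_two_same_layer assms mem by simp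
  next
    case 2
    then show ?thesis using within_two_layers_less mem by simp
  next
    case 3
    then show ?thesis
      using within_two_sym[OF pair_graph_Ka_star_Kb_star_G8] within_two_layers_less mem by simp
  qed
next
  let ?u = "(0, 0, 1, 0) :: nat \<times> nat \<times> int \<times> int"
  let ?v = "(0, 0, 1, 1) :: nat \<times> nat \<times> int \<times> int"
  show "?u \<in> pverts (Ka_star_Kb_star_G8 a b)" "?v \<in> pverts (Ka_star_Kb_star_G8 a b)"
    using assms by (simp_all add: verts_product G8_verts_def)
  show "?u \<noteq> ?v" by simp
  show "(?u, ?v) \<notin> parcs (Ka_star_Kb_star_G8 a b)"
    using assms by (simp add: arc_same_copy G8_arc_iff)
qed

end
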